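(* Let $n\ge 2$ and let $(G,f)$ be a finite $n$-ary group. Let $\chi,\psi\in\mathrm{Irr}(G,f)$, let $p\in\ker\chi$, $q\in\ker\psi$, and $a\in G$. Then $$\frac{1}{(n-1)|G|}\sum_{i=0}^{n-2}\sum_{x\in G}\chi\bigl(f(x,\stackrel{(i)}{a},\stackrel{(n-i-1)}{p})\bigr)\,\psi\bigl(f(x,\stackrel{(i)}{a},\stackrel{(n-i-1)}{q})\bigr)^{\ast}=\delta_{\chi,\psi},$$ where $\ast$ denotes complex conjugation and $\delta_{\chi,\psi}$ is $1$ if $\chi=\psi$ and $0$ otherwise.
   Context: Notation: $x_i^j$ denotes the sequence $x_i,x_{i+1},\ldots,x_j$ (empty if $j<i$), and $\stackrel{(t)}{x}$ denotes $x$ repeated $t$ times (empty if $t=0$). An $n$-ary group $(G,f)$ ($n\ge 2$), also called a polyadic group, is a non-empty set $G$ with an operation $f:G^n\to G$ that is associative, i.e. $f(x_1^{i-1},f(x_i^{n+i-1}),x_{n+i}^{2n-1})=f(x_1^{j-1},f(x_j^{n+j-1}),x_{n+j}^{2n-1})$ for all $1\le i,j\le n$ and $x_1,\ldots,x_{2n-1}\in G$, and such that for all $x_0,x_1,\ldots,x_n\in G$ and each $i\in\{1,\ldots,n\}$ there is a unique $z\in G$ with $f(x_1^{i-1},z,x_{i+1}^n)=x_0$. A representation of $(G,f)$ of degree $m\ge 1$ is a map $\Lambda:G\to GL_m(\mathbb{C})$ with $\Lambda(f(x_1^n))=\Lambda(x_1)\Lambda(x_2)\cdots\Lambda(x_n)$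 for all $x_1,\ldots,x_n\in G$. It is irreducible if no subspace of $\mathbb{C}^m$ other than $0$ and $\mathbb{C}^m$ is invariant under all $\Lambda(x)$, $x\in G$. The character of $\Lambda$ is the function $\chi:G\to\mathbb{C}$, $\chi(x)=\mathrm{Tr}\,\Lambda(x)$. $\mathrm{Irr}(G,f)$ is the set of characters of irreducible representations of $(G,f)$. For $\chi\in\mathrm{Irr}(G,f)$, the character of an irreducible representation $\Lambda$ of degree $m$, the kernel is $\ker\chi=\{x\in G:\Lambda(x)=I_m\}$, with $I_m$ the identity matrix; it may be empty, and the hypotheses $p\in\ker\chi$, $q\in\ker\psi$ in particular require the kernels to be non-empty. *)

theory Defs
  imports Complex_Main "HOL-Library.FuncSet" "Jordan_Normal_Form.VS_Connect"
begin

text \<open>An $n$-ary operation on \<open>G\<close> is given by a function on lists, of which only the values on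
  lists of length \<open>n\<close> over \<open>G\<close> matter. List positions are counted from 0, so the indices
  $1 \le i, j \le n$ of the associativity and solvability laws appear as \<open>i, j < n\<close>.\<close>

locale polyadic_group =
  fixes n :: nat and G :: "'a set" and f :: "'a list \<Rightarrow> 'a"
  assumes arity: "n \<ge> 2"
    and nonempty: "G \<noteq> {}"
    and closed: "\<And>xs. length xs = n \<Longrightarrow> set xs \<subseteq> G \<Longrightarrow> f xs \<in> G"
    and assoc: "\<And>xs i j. length xs = 2 * n - 1 \<Longrightarrow> set xs \<subseteq> G \<Longrightarrow> i < n \<Longrightarrow> j < n \<Longrightarrow>
      f (take i xs @ [f (take n (drop i xs))] @ drop (i + n) xs) =
      f (take j xs @ [f (take n (drop j xs))] @ drop (j + n) xs)"
    and solvable: "\<And>xs y i. length xs = n \<Longrightarrow> set xs \<subseteq> G \<Longrightarrow> y \<in> G \<Longrightarrow> i < n \<Longrightarrow>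
      \<exists>!z. z \<in> G \<and> f (xs[i := z]) = y"

definition mat_trace :: "complex mat \<Rightarrow> complex" where
  "mat_trace A = (\<Sum>i<dim_row A. A $$ (i, i))"

definition representation ::
  "nat \<Rightarrow> 'a set \<Rightarrow> ('a list \<Rightarrow> 'a) \<Rightarrow> nat \<Rightarrow> ('a \<Rightarrow> complex mat) \<Rightarrow> bool" where
  "representation n G f m \<Lambda> \<longleftrightarrow>
     m \<ge> 1 \<and>
     (\<forall>x\<in>G. \<Lambda> x \<in> carrier_mat m m \<and> invertible_mat (\<Lambda> x)) \<and>
     (\<forall>xs. length xs = n \<and> set xs \<subseteq> G \<longrightarrow> \<Lambda> (f xs) = foldr (*) (map \<Lambda> xs) (1\<^sub>m m))"

definition irreducible_rep ::
  "nat \<Rightarrow> 'a set \<Rightarrow> ('a list \<Rightarrow> 'a) \<Rightarrow> nat \<Rightarrow> ('a \<Rightarrow> complex mat) \<Rightarrow> bool" where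
  "irreducible_rep n G f m \<Lambda> \<longleftrightarrow>
     representation n G f m \<Lambda> \<and>
     (\<forall>W. VectorSpace.subspace class_ring W (module_vec TYPE(complex) m) \<and>
          (\<forall>x\<in>G. \<forall>w\<in>W. \<Lambda> x *\<^sub>v w \<in> W) \<longrightarrow>
          W = {0\<^sub>v m} \<or> W = carrier_vec m)"

text \<open>Characters are functions on \<open>G\<close>: they are made \<open>undefined\<close> outside \<open>G\<close>, so that
  equality of HOL functions is equality of characters on \<open>G\<close>.\<close>

definition rep_character :: "'a set \<Rightarrow> ('a \<Rightarrow> complex mat) \<Rightarrow> 'a \<Rightarrow> complex" where
  "rep_character G \<Lambda> = (\<lambda>x\<in>G. mat_trace (\<Lambda> x))"

definition Irr :: "nat \<Rightarrow> 'a set \<Rightarrow> ('a list \<Rightarrow> 'a) \<Rightarrow> ('a \<Rightarrow> complex) set" where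
  "Irr n G f = {\<chi>. \<exists>m \<Lambda>. irreducible_rep n G f m \<Lambda> \<and> \<chi> = rep_character G \<Lambda>}"

text \<open>For finite \<open>G\<close> the condition \<open>\<Lambda> x = 1\<^sub>m m\<close> does not depend on the choice of the irreducible
  representation \<open>\<Lambda>\<close> with character \<open>\<chi>\<close>, so the existential quantifier below describes
  the kernel of any such \<open>\<Lambda>\<close>.\<close>

definition char_kernel ::
  "nat \<Rightarrow> 'a set \<Rightarrow> ('a list \<Rightarrow> 'a) \<Rightarrow> ('a \<Rightarrow> complex) \<Rightarrow> 'a set" where
  "char_kernel n G f \<chi> = {x \<in> G. \<exists>m \<Lambda>. irreducible_rep n G f m \<Lambda> \<and>
      rep_character G \<Lambda> = \<chi> \<and> \<Lambda> x = 1\<^sub>m m}"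

end

theory Submission
  imports Defs "Jordan_Normal_Form.Spectral_Radius"
begin

text \<open>Products of the matrices \<open>\<Lambda> x\<close> behave like a representation of Post's covering group of
  \<open>(G, f)\<close>, each element of which is uniquely \<open>x a\<^sup>i\<close> with \<open>x \<in> G\<close> and \<open>i < n - 1\<close>. The covering group
  itself is not needed: solvability yields, for \<open>y \<in> G\<close>, a permutation of the pairs \<open>(i, x)\<close> that
  realises left multiplication by \<open>y\<close> in all representations at once, which is enough for
  Schur averaging. Since \<open>\<Lambda> p = 1\<close>, the summand of the theorem is
  the trace of \<open>\<Lambda> x (\<Lambda> a)\<^sup>i\<close> times the conjugate trace for the second representation, so the sum is an inner
  product of two irreducible characters. It remains to see that equality of the characters on \<open>G\<close>
  forces equivalence: otherwise the representations could differ by a twist with a root of unity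
  \<open>z\<close>, but then \<open>\<chi> = z \<chi>\<close>, and \<open>\<chi> p \<noteq> 0\<close> gives \<open>z = 1\<close>.\<close>

subsection \<open>Sums of matrices, traces and conjugate transposes\<close>

text \<open>The dimensions are parameters because an empty family does not determine the size of its
  zero matrix.\<close>

definition mat_sum :: "nat \<Rightarrow> nat \<Rightarrow> ('i \<Rightarrow> complex mat) \<Rightarrow> 'i set \<Rightarrow> complex mat" where
  "mat_sum r c F I = mat r c (\<lambda>(u, v). \<Sum>g\<in>I. F g $$ (u, v))"

lemma mat_sum_carrier [simp]: "mat_sum r c F I \<in> carrier_mat r c"
  "dim_row (mat_sum r c F I) = r" "dim_col (mat_sum r c F I) = c"
  by (auto simp: mat_sum_def)

lemma mat_sum_index: "u < r \<Longrightarrow> v < c \<Longrightarrow> mat_sum r c F I $$ (u, v) = (\<Sum>g\<in>I. F g $$ (u, v))"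
  by (simp add: mat_sum_def)

lemma mat_sum_cong: "(\<And>g. g \<in> I \<Longrightarrow> F g = F' g) \<Longrightarrow> mat_sum r c F I = mat_sum r c F' I"
  by (simp add: mat_sum_def cong: sum.cong)

lemma mult_mat_index:
  "A \<in> carrier_mat r k \<Longrightarrow> B \<in> carrier_mat k c \<Longrightarrow> u < r \<Longrightarrow> v < c \<Longrightarrow>
    (A * B) $$ (u, v) = (\<Sum>w<k. A $$ (u, w) * B $$ (w, v))"
  by (auto simp: scalar_prod_def atLeast0LessThan)

lemma mat_sum_mult_left:
  assumes Y: "Y \<in> carrier_mat r' r" and F: "\<And>g. g \<in> I \<Longrightarrow> F g \<in> carrier_mat r c"
  shows "Y * mat_sum r c F I = mat_sum r' c (\<lambda>g. Y * F g) I"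
proof (rule eq_matI)
  fix u v assume "u < dim_row (mat_sum r' c (\<lambda>g. Y * F g) I)" "v < dim_col (mat_sum r' c (\<lambda>g. Y * F g) I)"
  then have uv: "u < r'" "v < c" by auto
  have "(Y * mat_sum r c F I) $$ (u, v) = (\<Sum>w<r. \<Sum>g\<in>I. Y $$ (u, w) * F g $$ (w, v))"
    using uv by (subst mult_mat_index[OF Y mat_sum_carrier(1)])
      (auto simp: mat_sum_index sum_distrib_left)
  also have "\<dots> = (\<Sum>g\<in>I. (Y * F g) $$ (u, v))"
    using uv by (subst sum.swap) (auto intro!: sum.cong simp: mult_mat_index[OF Y F])
  finally show "(Y * mat_sum r c F I) $$ (u, v) = mat_sum r' c (\<lambda>g. Y * F g) I $$ (u, v)"
    using uv by (simp add: mat_sum_index)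
qed (use Y in auto)

lemma mat_sum_mult_right:
  assumes X: "X \<in> carrier_mat c c'" and F: "\<And>g. g \<in> I \<Longrightarrow> F g \<in> carrier_mat r c"
  shows "mat_sum r c F I * X = mat_sum r c' (\<lambda>g. F g * X) I"
proof (rule eq_matI)
  fix u v assume "u < dim_row (mat_sum r c' (\<lambda>g. F g * X) I)" "v < dim_col (mat_sum r c' (\<lambda>g. F g * X) I)"
  then have uv: "u < r" "v < c'" by auto
  have "(mat_sum r c F I * X) $$ (u, v) = (\<Sum>w<c. \<Sum>g\<in>I. F g $$ (u, w) * X $$ (w, v))"
    using uv by (subst mult_mat_index[OF mat_sum_carrier(1) X])
      (auto simp: mat_sum_index sum_distrib_right)
  also have "\<dots> = (\<Sum>g\<in>I. (F g * X) $$ (u, v))"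
    using uv by (subst sum.swap) (auto intro!: sum.cong simp: mult_mat_index[OF F X])
  finally show "(mat_sum r c F I * X) $$ (u, v) = mat_sum r c' (\<lambda>g. F g * X) I $$ (u, v)"
    using uv by (simp add: mat_sum_index)
qed (use X in auto)

text \<open>Reindexing along the permutation \<open>t\<close> turns a relation between summands into
  one for the whole sum. This is the averaging step: it yields the invariant form and all
  intertwiners of the orthogonality relations.\<close>

lemma mat_sum_intertwine:
  assumes bij: "bij_betw t I I"
    and F: "\<And>g. g \<in> I \<Longrightarrow> F g \<in> carrier_mat r c"
    and X: "X \<in> carrier_mat c c" and Y: "Y \<in> carrier_mat r r"
    and FX: "\<And>g. g \<in> I \<Longrightarrow> F (t g) * X = Y * F g"
  shows "mat_sum r c F I * X = Y * mat_sum r c F I"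
proof -
  have "mat_sum r c F I = mat_sum r c (\<lambda>g. F (t g)) I"
    unfolding mat_sum_def by (intro eq_matI) (auto intro!: sum.reindex_bij_betw[OF bij, symmetric])
  moreover have "\<And>g. g \<in> I \<Longrightarrow> F (t g) \<in> carrier_mat r c"
    using bij F by (metis bij_betwE)
  ultimately have "mat_sum r c F I * X = mat_sum r c (\<lambda>g. F (t g) * X) I"
    using mat_sum_mult_right[OF X] by metis
  also have "\<dots> = mat_sum r c (\<lambda>g. Y * F g) I"
    by (rule mat_sum_cong) (rule FX)
  also have "\<dots> = Y * mat_sum r c F I"
    by (rule mat_sum_mult_left[OF Y F, symmetric])
  finally show ?thesis .
qed

section \<open>Traces, conjugate transposes and inverses\<close>

lemma mat_trace_alt: "A \<in> carrier_mat m m \<Longrightarrow> mat_trace A = (\<Sum>i<m. A $$ (i, i))"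
  by (auto simp: mat_trace_def)

lemma mat_trace_one [simp]: "mat_trace (1\<^sub>m m) = of_nat m"
  by (simp add: mat_trace_def)

lemma mat_trace_smult: "A \<in> carrier_mat m m \<Longrightarrow> mat_trace (c \<cdot>\<^sub>m A) = c * mat_trace A"
  by (auto simp: mat_trace_def sum_distrib_left)

text \<open>Rectangular factors are allowed, because an intertwiner between representations of
  degrees \<open>m\<close> and \<open>k\<close> is not known to be square.\<close>

lemma mat_trace_mult_comm:
  assumes "A \<in> carrier_mat m k" "B \<in> carrier_mat k m"
  shows "mat_trace (A * B) = mat_trace (B * A)"
proof -
  have "mat_trace (A * B) = (\<Sum>i<m. \<Sum>j<k. A $$ (i, j) * B $$ (j, i))"
    using assms by (subst mat_trace_alt[where m = m]) (auto simp: scalar_prod_def atLeast0LessThan)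
  also have "\<dots> = (\<Sum>j<k. \<Sum>i<m. B $$ (j, i) * A $$ (i, j))"
    by (subst sum.swap) (simp add: mult.commute)
  also have "\<dots> = mat_trace (B * A)"
    using assms by (subst mat_trace_alt[where m = k]) (auto simp: scalar_prod_def atLeast0LessThan)
  finally show ?thesis .
qed

definition conj_transpose :: "complex mat \<Rightarrow> complex mat" where
  "conj_transpose A = map_mat cnj (transpose_mat A)"

lemma conj_transpose_carrier [simp]:
  "A \<in> carrier_mat r c \<Longrightarrow> conj_transpose A \<in> carrier_mat c r"
  by (auto simp: conj_transpose_def)

lemma conj_transpose_mult:
  assumes "A \<in> carrier_mat r k" "B \<in> carrier_mat k c"
  shows "conj_transpose (A * B) = conj_transpose B * conj_transpose A"
  using assms by (intro eq_matI)
    (auto simp: conj_transpose_def scalar_prod_def mult.commute)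

lemma conj_transpose_one [simp]: "conj_transpose (1\<^sub>m m) = 1\<^sub>m m"
  by (intro eq_matI) (auto simp: conj_transpose_def)

lemma mat_trace_conj_transpose:
  "A \<in> carrier_mat m m \<Longrightarrow> mat_trace (conj_transpose A) = cnj (mat_trace A)"
  by (auto simp: mat_trace_def conj_transpose_def)

lemma invertible_mat_obtain:
  fixes A :: "complex mat"
  assumes "A \<in> carrier_mat m m" "invertible_mat A"
  obtains B where "B \<in> carrier_mat m m" "A * B = 1\<^sub>m m" "B * A = 1\<^sub>m m"
proof -
  obtain B where B: "A * B = 1\<^sub>m m" "B * A = 1\<^sub>m (dim_row B)"
    using assms unfolding invertible_mat_def inverts_mat_def by auto
  \<comment> \<open>\<open>inverts_mat\<close> leaves the size of \<open>B\<close> open; comparing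
    the dimensions of both sides fixes it.\<close>
  have "dim_col B = m" using arg_cong[OF B(1), of dim_col] by simp
  moreover have "dim_row B = m" using arg_cong[OF B(2), of dim_col] assms(1) by simp
  ultimately show ?thesis using that B by auto
qed

subsection \<open>Schur's lemma\<close>

lemma mult_mat_unit_vec:
  fixes A :: "'b :: semiring_1 mat"
  shows "A \<in> carrier_mat r c \<Longrightarrow> i < c \<Longrightarrow> A *\<^sub>v unit_vec c i = col A i"
  by (intro eq_vecI) auto

text \<open>Replaces the module-theoretic notion of subspace by closure conditions on vectors, ready
  for images and kernels.\<close>

lemma irreducible_rep_invariant:
  assumes irr: "irreducible_rep n G f m L"
    and W: "W \<subseteq> carrier_vec m" "0\<^sub>v m \<in> W"
    and add: "\<And>v w. v \<in> W \<Longrightarrow> w \<in> W \<Longrightarrow> v + w \<in> W"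
    and smult: "\<And>c v. v \<in> W \<Longrightarrow> c \<cdot>\<^sub>v v \<in> W"
    and inv: "\<And>x w. x \<in> G \<Longrightarrow> w \<in> W \<Longrightarrow> L x *\<^sub>v w \<in> W"
  shows "W = {0\<^sub>v m} \<or> W = carrier_vec m"
proof -
  have "VectorSpace.subspace class_ring W (module_vec TYPE(complex) m)"
    unfolding VectorSpace.subspace_def submodule_def
    using W add smult vec_vs vec_module by (auto simp: module_vec_simps)
  then show ?thesis
    using irr inv unfolding irreducible_rep_def by blast
qed

text \<open>The range of \<open>S\<close> is invariant under \<open>L\<close> and nonzero, hence the
  whole space. Here \<open>T\<close> may be any family of matrices; \<open>invariant_form\<close>
  takes the conjugate transposes of the inverses of a representation.\<close>

lemma schur_right_inverse:
  assumes irr: "irreducible_rep n G f m L"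
    and S: "S \<in> carrier_mat m k" "S \<noteq> 0\<^sub>m m k"
    and T: "\<And>y. y \<in> G \<Longrightarrow> T y \<in> carrier_mat k k" "\<And>y. y \<in> G \<Longrightarrow> L y * S = S * T y"
  obtains R where "R \<in> carrier_mat k m" "S * R = 1\<^sub>m m"
proof -
  have L: "\<And>y. y \<in> G \<Longrightarrow> L y \<in> carrier_mat m m"
    using irr by (auto simp: irreducible_rep_def representation_def)
  define W where "W = (\<lambda>v. S *\<^sub>v v) ` carrier_vec k"
  have "W = {0\<^sub>v m} \<or> W = carrier_vec m"
  proof (rule irreducible_rep_invariant[OF irr])
    show "W \<subseteq> carrier_vec m" using S by (auto simp: W_def)
    have "S *\<^sub>v 0\<^sub>v k = 0\<^sub>v m" using S by auto
    then show "0\<^sub>v m \<in> W" unfolding W_def by (metis imageI zero_carrier_vec)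
    show "v + w \<in> W" if vw: "v \<in> W" "w \<in> W" for v w
    proof -
      obtain v' w' where "v' \<in> carrier_vec k" "v = S *\<^sub>v v'" "w' \<in> carrier_vec k" "w = S *\<^sub>v w'"
        using vw by (auto simp: W_def)
      then have "v + w = S *\<^sub>v (v' + w')" "v' + w' \<in> carrier_vec k"
        using S by (simp_all add: mult_add_distrib_mat_vec)
      then show ?thesis unfolding W_def by blast
    qed
    show "c \<cdot>\<^sub>v v \<in> W" if v: "v \<in> W" for c v
    proof -
      obtain v' where "v' \<in> carrier_vec k" "v = S *\<^sub>v v'"
        using v by (auto simp: W_def)
      then have "c \<cdot>\<^sub>v v = S *\<^sub>v (c \<cdot>\<^sub>v v')" "c \<cdot>\<^sub>v v' \<in> carrier_vec k"
        using S by (simp_all add: mult_mat_vec)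
      then show ?thesis unfolding W_def by blast
    qed
    show "L x *\<^sub>v w \<in> W" if x: "x \<in> G" and w: "w \<in> W" for x w
    proof -
      obtain v where v: "v \<in> carrier_vec k" "w = S *\<^sub>v v" using w by (auto simp: W_def)
      have "L x *\<^sub>v w = (L x * S) *\<^sub>v v" 
        using assoc_mult_mat_vec[OF L[OF x] S(1) v(1)] v(2) by simp
      also have "\<dots> = S *\<^sub>v (T x *\<^sub>v v)"
        using T x assoc_mult_mat_vec[OF S(1) T(1)[OF x] v(1)] by simp
      finally show ?thesis using T(1)[OF x] v by (auto simp: W_def)
    qed
  qed
  moreover have "W \<noteq> {0\<^sub>v m}"
  proof
    assume W: "W = {0\<^sub>v m}"
    have "S = 0\<^sub>m m k"
    proof (rule mat_col_eqI)
      fix i assume "i < dim_col (0\<^sub>m m k :: complex mat)"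
      then have i: "i < k" by simp
      have "col S i = S *\<^sub>v unit_vec k i" using S i by (simp add: mult_mat_unit_vec)
      also have "\<dots> = 0\<^sub>v m" using W unfolding W_def by (metis imageI singletonD unit_vec_carrier)
      finally show "col S i = col (0\<^sub>m m k) i" using i by (simp add: col_zero)
    qed (use S in auto)
    with S show False by simp
  qed
  ultimately have surj: "W = carrier_vec m" by simp
  have "\<forall>i. \<exists>v. v \<in> carrier_vec k \<and> S *\<^sub>v v = unit_vec m i"
  proof
    fix i
    have "unit_vec m i \<in> W" unfolding surj by simp
    then show "\<exists>v. v \<in> carrier_vec k \<and> S *\<^sub>v v = unit_vec m i" unfolding W_def by force
  qed
  then obtain r where r: "\<And>i. r i \<in> carrier_vec k" "\<And>i. S *\<^sub>v r i = unit_vec m i" by metis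
  \<comment> \<open>The columns of \<open>R\<close> are preimages of the standard basis
    vectors.\<close>
  define R where "R = mat_of_cols k (map r [0..<m])"
  have R: "R \<in> carrier_mat k m" by (auto simp: R_def)
  have "S * R = 1\<^sub>m m"
  proof (rule mat_col_eqI)
    fix i assume "i < dim_col (1\<^sub>m m :: complex mat)"
    then have i: "i < m" by simp
    have "col (S * R) i = S *\<^sub>v col R i" by (rule col_mult2[OF S(1) R i])
    also have "col R i = r i" using i r by (simp add: R_def)
    finally show "col (S * R) i = col (1\<^sub>m m) i" using i r by simp
  qed (use S R in auto)
  with R that show ?thesis by blast
qed

text \<open>The kernel of \<open>S\<close> is invariant under \<open>K\<close> and is not the whole
  space because \<open>S\<close> is nonzero, so irreducibility makes it trivial.\<close>

lemma schur_injective: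
  assumes irr: "irreducible_rep n G f k K"
    and S: "S \<in> carrier_mat m k" "S \<noteq> 0\<^sub>m m k"
    and T: "\<And>y. y \<in> G \<Longrightarrow> T y \<in> carrier_mat m m" "\<And>y. y \<in> G \<Longrightarrow> T y * S = S * K y"
    and v: "v \<in> carrier_vec k" "S *\<^sub>v v = 0\<^sub>v m"
  shows "v = 0\<^sub>v k"
proof -
  have K: "\<And>y. y \<in> G \<Longrightarrow> K y \<in> carrier_mat k k"
    using irr by (auto simp: irreducible_rep_def representation_def)
  define W where "W = {v \<in> carrier_vec k. S *\<^sub>v v = 0\<^sub>v m}"
  have "W = {0\<^sub>v k} \<or> W = carrier_vec k"
  proof (rule irreducible_rep_invariant[OF irr])
    show "W \<subseteq> carrier_vec k" by (auto simp: W_def)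
    show "0\<^sub>v k \<in> W" using S by (auto simp: W_def)
    show "v + w \<in> W" if "v \<in> W" "w \<in> W" for v w
      using that S unfolding W_def by (auto simp: mult_add_distrib_mat_vec)
    show "c \<cdot>\<^sub>v v \<in> W" if "v \<in> W" for c v
      using that S unfolding W_def by (auto simp: mult_mat_vec)
    show "K x *\<^sub>v w \<in> W" if x: "x \<in> G" and w: "w \<in> W" for x w
    proof -
      have wk: "w \<in> carrier_vec k" "S *\<^sub>v w = 0\<^sub>v m" using w by (auto simp: W_def)
      have "S *\<^sub>v (K x *\<^sub>v w) = (S * K x) *\<^sub>v w"
        using assoc_mult_mat_vec[OF S(1) K[OF x] wk(1)] by simp
      also have "\<dots> = T x *\<^sub>v (S *\<^sub>v w)"
        using assoc_mult_mat_vec[OF T(1)[OF x] S(1) wk(1)] T(2)[OF x] by simp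
      also have "\<dots> = 0\<^sub>v m" using wk T(1)[OF x] by auto
      finally show ?thesis using K[OF x] wk(1) by (auto simp: W_def)
    qed
  qed
  moreover have "W \<noteq> carrier_vec k"
  proof
    assume W: "W = carrier_vec k"
    have "S = 0\<^sub>m m k"
    proof (rule mat_col_eqI)
      fix i assume "i < dim_col (0\<^sub>m m k :: complex mat)"
      then have i: "i < k" by simp
      have "col S i = S *\<^sub>v unit_vec k i" using S i by (simp add: mult_mat_unit_vec)
      also have "unit_vec k i \<in> W" unfolding W by simp
      then have "S *\<^sub>v unit_vec k i = 0\<^sub>v m" by (simp add: W_def)
      finally show "col S i = col (0\<^sub>m m k) i" using i by (simp add: col_zero)
    qed (use S in auto)
    with S show False by simp
  qed
  ultimately show ?thesis using v by (auto simp: W_def)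
qed

text \<open>Irreducibility of \<open>L\<close> gives a right inverse \<open>R\<close>. Since
  \<open>S * (R * S) = S\<close>, each column of \<open>R * S\<close> differs from the unit vector
  by an element of the kernel of \<open>S\<close>, which is zero by irreducibility of
  \<open>K\<close>. The degrees need not be compared beforehand.\<close>

lemma schur_invertible:
  assumes L: "irreducible_rep n G f m L" and K: "irreducible_rep n G f k K"
    and S: "S \<in> carrier_mat m k" "S \<noteq> 0\<^sub>m m k"
    and LS: "\<And>y. y \<in> G \<Longrightarrow> L y * S = S * K y"
  obtains R where "R \<in> carrier_mat k m" "S * R = 1\<^sub>m m" "R * S = 1\<^sub>m k"
proof -
  have Lc: "\<And>y. y \<in> G \<Longrightarrow> L y \<in> carrier_mat m m" and Kc: "\<And>y. y \<in> G \<Longrightarrow> K y \<in> carrier_mat k k"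
    using L K by (auto simp: irreducible_rep_def representation_def)
  obtain R where R: "R \<in> carrier_mat k m" "S * R = 1\<^sub>m m"
    using schur_right_inverse[OF L S Kc LS] by blast
  have "R * S = 1\<^sub>m k"
  proof (rule mat_col_eqI)
    fix i assume "i < dim_col (1\<^sub>m k :: complex mat)"
    then have i: "i < k" by simp
    have RS: "R * S \<in> carrier_mat k k" using R S by simp
    then have c: "col (R * S) i \<in> carrier_vec k" using i by auto
    have "S *\<^sub>v col (R * S) i = col (S * (R * S)) i"
      using col_mult2[OF S(1) RS i] by simp
    also have "S * (R * S) = S"
      using assoc_mult_mat[OF S(1) R(1) S(1)] R S by simp
    also have "col S i = S *\<^sub>v unit_vec k i" using S i by (simp add: mult_mat_unit_vec)
    finally have "S *\<^sub>v (col (R * S) i - unit_vec k i) = 0\<^sub>v m"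
      using S c by (auto simp: mult_minus_distrib_mat_vec)
    then have "col (R * S) i - unit_vec k i = 0\<^sub>v k"
      using schur_injective[OF K S Lc LS] c by simp
    then have "col (R * S) i $ j = unit_vec k i $ j" if "j < k" for j
      using that c by (metis eq_iff_diff_eq_0 index_minus_vec(1) index_unit_vec(3) index_zero_vec(1))
    then have "col (R * S) i = unit_vec k i"
      using c by (intro eq_vecI) (simp_all del: index_col index_mult_mat dim_col add: carrier_vecD)
    then show "col (R * S) i = col (1\<^sub>m k) i" using i by simp
  qed (use R S in auto)
  with R that show ?thesis by blast
qed

subsection \<open>Products along words and twists by roots of unity\<close>

definition word_prod :: "nat \<Rightarrow> ('a \<Rightarrow> complex mat) \<Rightarrow> 'a list \<Rightarrow> complex mat" where
  "word_prod m L xs = foldr (*) (map L xs) (1\<^sub>m m)"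

lemma word_prod_simps [simp]:
  "word_prod m L [] = 1\<^sub>m m" "word_prod m L (x # xs) = L x * word_prod m L xs"
  by (simp_all add: word_prod_def)

lemma word_prod_carrier [simp]:
  "(\<And>x. x \<in> set xs \<Longrightarrow> L x \<in> carrier_mat m m) \<Longrightarrow> word_prod m L xs \<in> carrier_mat m m"
proof (induction xs)
  case (Cons x xs)
  then show ?case by (simp add: mult_carrier_mat[of _ m m])
qed simp

lemma word_prod_append:
  "(\<And>x. x \<in> set xs \<union> set ys \<Longrightarrow> L x \<in> carrier_mat m m) \<Longrightarrow>
    word_prod m L (xs @ ys) = word_prod m L xs * word_prod m L ys"
proof (induction xs)
  case Nil
  then have "word_prod m L ys \<in> carrier_mat m m" by simp
  then show ?case by simp
next
  case (Cons x xs)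
  then show ?case
    by (simp add: assoc_mult_mat[of _ m m _ m _ m])
qed

lemma word_prod_inverse:
  assumes "\<And>x. x \<in> set xs \<Longrightarrow> L x \<in> carrier_mat m m" "\<And>x. x \<in> set xs \<Longrightarrow> invertible_mat (L x)"
  obtains B where "B \<in> carrier_mat m m" "word_prod m L xs * B = 1\<^sub>m m" "B * word_prod m L xs = 1\<^sub>m m"
  using assms
proof (induction xs arbitrary: thesis)
  case Nil
  show ?case by (rule Nil(1)[of "1\<^sub>m m"]) simp_all
next
  case (Cons x xs)
  obtain C where C: "C \<in> carrier_mat m m" "word_prod m L xs * C = 1\<^sub>m m" "C * word_prod m L xs = 1\<^sub>m m"
    by (rule Cons.IH) (use Cons.prems in auto)
  obtain D where D: "D \<in> carrier_mat m m" "L x * D = 1\<^sub>m m" "D * L x = 1\<^sub>m m"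
    by (rule invertible_mat_obtain[of "L x" m]) (use Cons.prems in auto)
  have Lx: "L x \<in> carrier_mat m m" and W: "word_prod m L xs \<in> carrier_mat m m"
    using Cons.prems by simp_all
  have "L x * word_prod m L xs * (C * D) = L x * (word_prod m L xs * C * D)"
    using Lx W C(1) D(1) by (simp add: assoc_mult_mat[of _ m m _ m _ m])
  moreover have "C * D * (L x * word_prod m L xs) = C * (D * L x * word_prod m L xs)"
    using Lx W C(1) D(1) by (simp add: assoc_mult_mat[of _ m m _ m _ m])
  ultimately show ?case
    using C D W by (intro Cons.prems(1)[of "C * D"]) auto
qed

lemma word_prod_intertwine:
  assumes "S \<in> carrier_mat m k"
    and "\<And>x. x \<in> set xs \<Longrightarrow> L x \<in> carrier_mat m m" "\<And>x. x \<in> set xs \<Longrightarrow> K x \<in> carrier_mat k k"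
    and "\<And>x. x \<in> set xs \<Longrightarrow> L x * S = S * K x"
  shows "word_prod m L xs * S = S * word_prod k K xs"
  using assms(2-4)
proof (induction xs)
  case Nil
  then show ?case using assms(1) by simp
next
  case (Cons x xs)
  have c: "L x \<in> carrier_mat m m" "K x \<in> carrier_mat k k" "word_prod m L xs \<in> carrier_mat m m"
    "word_prod k K xs \<in> carrier_mat k k" using Cons.prems by simp_all
  have "L x * word_prod m L xs * S = L x * (word_prod m L xs * S)"
    using c assms(1) by (simp add: assoc_mult_mat[of _ m m _ m _ k])
  also have "word_prod m L xs * S = S * word_prod k K xs" using Cons by simp
  also have "L x * (S * word_prod k K xs) = L x * S * word_prod k K xs"
    using c assms(1) by (simp add: assoc_mult_mat[of _ m m _ k _ k])
  also have "L x * S = S * K x" using Cons.prems by simp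
  also have "S * K x * word_prod k K xs = S * (K x * word_prod k K xs)"
    using c assms(1) by (simp add: assoc_mult_mat[of _ m k _ k _ k])
  finally show ?case by simp
qed

section \<open>Scalar multiples of representations\<close>

lemma smult_smult_mat: "z \<cdot>\<^sub>m (w \<cdot>\<^sub>m A) = (z * w) \<cdot>\<^sub>m (A :: complex mat)"
  by (intro eq_matI) auto

lemma one_smult_mat: "1 \<cdot>\<^sub>m A = (A :: complex mat)"
  by (intro eq_matI) auto

lemma word_prod_smult:
  "(\<And>x. x \<in> set xs \<Longrightarrow> L x \<in> carrier_mat m m) \<Longrightarrow>
    word_prod m (\<lambda>x. z \<cdot>\<^sub>m L x) xs = z ^ length xs \<cdot>\<^sub>m word_prod m L xs"
proof (induction xs)
  case Nil
  then show ?case by auto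
next
  case (Cons x xs)
  have c: "L x \<in> carrier_mat m m" "word_prod m L xs \<in> carrier_mat m m" using Cons.prems by simp_all
  then have "z \<cdot>\<^sub>m L x * (z ^ length xs \<cdot>\<^sub>m word_prod m L xs)
      = z \<cdot>\<^sub>m (z ^ length xs \<cdot>\<^sub>m (L x * word_prod m L xs))"
    by (simp add: mult_smult_assoc_mat[of _ m m _ m] mult_smult_distrib[of _ m m _ m]
        smult_smult_mat mult.commute)
  then show ?case using Cons by (simp add: smult_smult_mat)
qed

lemma word_prod_replicate_one: "L p = 1\<^sub>m m \<Longrightarrow> word_prod m L (replicate i p) = 1\<^sub>m m"
  by (induction i) auto

lemma mat_mult_right_cancel:
  fixes A B C :: "complex mat"
  assumes "A \<in> carrier_mat r m" "B \<in> carrier_mat r m" "C \<in> carrier_mat m m" "D \<in> carrier_mat m m"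
    and "C * D = 1\<^sub>m m" "A * C = B * C"
  shows "A = B"
proof -
  have "A * C * D = B * C * D" using assms by simp
  then show ?thesis using assms(1-5) by (simp add: assoc_mult_mat[of _ r m _ m _ m])
qed

lemma representationD:
  assumes "representation n G f m L"
  shows "m \<ge> 1" "\<And>x. x \<in> G \<Longrightarrow> L x \<in> carrier_mat m m" "\<And>x. x \<in> G \<Longrightarrow> invertible_mat (L x)"
    "\<And>xs. length xs = n \<Longrightarrow> set xs \<subseteq> G \<Longrightarrow> L (f xs) = word_prod m L xs"
  using assms by (auto simp: representation_def word_prod_def)

lemma irreducible_rep_representation: "irreducible_rep n G f m L \<Longrightarrow> representation n G f m L"
  by (simp add: irreducible_rep_def)

text \<open>The law for words of length \<open>n\<close> requires \<open>z ^ n = z\<close>, which is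
  what \<open>z ^ (n - 1) = 1\<close> provides.\<close>

lemma representation_twist:
  assumes rep: "representation n G f m L" and z: "z ^ (n - 1) = 1" and n: "n \<ge> 2"
  shows "representation n G f m (\<lambda>x. z \<cdot>\<^sub>m L x)"
  unfolding representation_def word_prod_def[symmetric]
proof (intro conjI ballI allI impI)
  note L = representationD[OF rep]
  have z0: "z \<noteq> 0" using z n by (auto simp: power_0_left)
  show "m \<ge> 1" by (rule L)
  fix x assume x: "x \<in> G"
  show "z \<cdot>\<^sub>m L x \<in> carrier_mat m m" using L(2)[OF x] by simp
  obtain B where B: "B \<in> carrier_mat m m" "L x * B = 1\<^sub>m m" "B * L x = 1\<^sub>m m"
    using L(2,3)[OF x] by (rule invertible_mat_obtain)
  have "(z \<cdot>\<^sub>m L x) * ((1 / z) \<cdot>\<^sub>m B) = 1\<^sub>m m" "((1 / z) \<cdot>\<^sub>m B) * (z \<cdot>\<^sub>m L x) = 1\<^sub>m m"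
    using B L(2)[OF x] z0
    by (simp_all add: mult_smult_assoc_mat[of _ m m _ m] mult_smult_distrib[of _ m m _ m] smult_smult_mat one_smult_mat)
  then show "invertible_mat (z \<cdot>\<^sub>m L x)"
    unfolding invertible_mat_def inverts_mat_def using L(2)[OF x] B(1)
    by (intro conjI exI[of _ "(1 / z) \<cdot>\<^sub>m B"]) auto
next
  note L = representationD[OF rep]
  fix xs assume xs: "length xs = n \<and> set xs \<subseteq> G"
  then have "\<And>x. x \<in> set xs \<Longrightarrow> L x \<in> carrier_mat m m" using L(2) by auto
  then have "word_prod m (\<lambda>x. z \<cdot>\<^sub>m L x) xs = z ^ n \<cdot>\<^sub>m word_prod m L xs"
    using xs by (simp add: word_prod_smult)
  moreover have "z ^ n = z" using z n by (cases n) auto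
  ultimately show "z \<cdot>\<^sub>m L (f xs) = word_prod m (\<lambda>x. z \<cdot>\<^sub>m L x) xs"
    using L(4) xs by simp
qed

text \<open>Multiplication by a nonzero scalar does not change which subspaces are
  invariant.\<close>

lemma irreducible_rep_twist:
  assumes irr: "irreducible_rep n G f m L" and z: "z ^ (n - 1) = 1" and n: "n \<ge> 2"
  shows "irreducible_rep n G f m (\<lambda>x. z \<cdot>\<^sub>m L x)"
  unfolding irreducible_rep_def
proof (intro conjI allI impI)
  note rep = irreducible_rep_representation[OF irr]
  show "representation n G f m (\<lambda>x. z \<cdot>\<^sub>m L x)"
    using rep z n by (rule representation_twist)
  fix W
  assume W: "VectorSpace.subspace class_ring W (module_vec TYPE(complex) m) \<and>
    (\<forall>x\<in>G. \<forall>w\<in>W. (z \<cdot>\<^sub>m L x) *\<^sub>v w \<in> W)"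
  have z0: "z \<noteq> 0" using z n by (auto simp: power_0_left)
  have sub: "submodule class_ring W (module_vec TYPE(complex) m)"
    using W by (simp add: VectorSpace.subspace_def)
  have "L x *\<^sub>v w \<in> W" if x: "x \<in> G" and w: "w \<in> W" for x w
  proof -
    have wm: "w \<in> carrier_vec m"
      using submodule.subset[OF sub] w by (auto simp: module_vec_simps)
    have "(1 / z) \<cdot>\<^sub>v ((z \<cdot>\<^sub>m L x) *\<^sub>v w) \<in> W"
      using submodule.smult_closed[OF sub, of "1 / z"] W x w
      by (simp add: module_vec_simps class_ring_simps)
    also have "(1 / z) \<cdot>\<^sub>v ((z \<cdot>\<^sub>m L x) *\<^sub>v w) = L x *\<^sub>v w"
      using representationD(2)[OF rep x] wm z0
      by (intro eq_vecI) (auto simp: scalar_prod_def sum_distrib_left)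
    finally show ?thesis .
  qed
  with W show "W = {0\<^sub>v m} \<or> W = carrier_vec m"
    using irr unfolding irreducible_rep_def by blast
qed

subsection \<open>Translations and the invariant Hermitian form\<close>

text \<open>The pair \<open>(i, x)\<close> stands for the element \<open>x a\<^sup>i\<close> of the covering group.\<close>

definition translates :: "nat \<Rightarrow> 'a set \<Rightarrow> (nat \<times> 'a) set" where
  "translates n G = {..<n - 1} \<times> G"

definition translate_word :: "'a \<Rightarrow> nat \<times> 'a \<Rightarrow> 'a list" where
  "translate_word a g = snd g # replicate (fst g) a"

lemma translate_word_set: "a \<in> G \<Longrightarrow> g \<in> translates n G \<Longrightarrow> set (translate_word a g) \<subseteq> G"
  by (auto simp: translates_def translate_word_def)

context polyadic_group
begin

text \<open>For \<open>i < n - 2\<close> the product \<open>y x a\<^sup>i\<close> is \<open>z a\<^sup>i\<^sup>+\<^sup>1\<close>, where \<open>z\<close> solves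
  \<open>f (z, a, \<dots>, a) = f (y, x, a, \<dots>, a)\<close>; for \<open>i = n - 2\<close> it is the single element
  \<open>f (y, x, a, \<dots>, a)\<close>.\<close>

lemma left_translation:
  assumes fin: "finite G" and a: "a \<in> G" and y: "y \<in> G"
  obtains t where "bij_betw t (translates n G) (translates n G)"
    and "\<And>m L g. representation n G f m L \<Longrightarrow> g \<in> translates n G \<Longrightarrow>
      word_prod m L (translate_word a (t g)) = L y * word_prod m L (translate_word a g)"
proof -
  have sol1: "\<exists>!z. z \<in> G \<and> f (z # replicate (n - 1) a) = u" if "u \<in> G" for u
    using solvable[of "replicate n a" u 0] that a arity by (cases n) auto
  \<comment> \<open>Solvability in position 1, with \<open>y\<close> fixed in position 0; its
    uniqueness makes \<open>c\<close> below injective.\<close>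
  have sol2: "\<exists>!z. z \<in> G \<and> f (y # z # replicate (n - 2) a) = u" if "u \<in> G" for u
  proof -
    have "n = Suc (Suc (n - 2))" using arity by simp
    then have "(y # replicate (n - 1) a)[1 := z] = y # z # replicate (n - 2) a" for z
      by (metis One_nat_def diff_Suc_1 list_update_code(2,3) replicate_Suc)
    then show ?thesis
      using solvable[of "y # replicate (n - 1) a" u 1] that a y arity by auto
  qed
  define c where "c x = f (y # x # replicate (n - 2) a)" for x
  have len: "length (y # x # replicate (n - 2) a) = n" "length (x # replicate (n - 1) a) = n" for x
    using arity by auto
  have cG: "c x \<in> G" if "x \<in> G" for x
    unfolding c_def using that a y len by (intro closed) auto
  have "\<forall>x. \<exists>z. x \<in> G \<longrightarrow> z \<in> G \<and> f (z # replicate (n - 1) a) = c x"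
    using sol1 cG by blast
  then obtain h where h: "\<And>x. x \<in> G \<Longrightarrow> h x \<in> G" "\<And>x. x \<in> G \<Longrightarrow> f (h x # replicate (n - 1) a) = c x"
    by metis
  have c_inj: "x = x'" if "x \<in> G" "x' \<in> G" "c x = c x'" for x x'
    using sol2[OF cG[OF that(1)]] that unfolding c_def by metis
  have h_inj: "x = x'" if "x \<in> G" "x' \<in> G" "h x = h x'" for x x'
    using h that c_inj by metis
  define t where "t = (\<lambda>(i, x). if i = n - 2 then (0, c x) else (i + 1, h x))"
  have "inj_on t (translates n G)"
    by (auto simp: inj_on_def t_def translates_def split: if_splits intro: c_inj h_inj)
  moreover have "t ` translates n G \<subseteq> translates n G"
    using arity cG h by (auto simp: t_def translates_def split: if_splits)
  moreover have "finite (translates n G)" using fin by (simp add: translates_def)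
  \<comment> \<open>An injective self-map of a finite set is a bijection.\<close>
  ultimately have bij: "bij_betw t (translates n G) (translates n G)"
    by (simp add: bij_betw_def endo_inj_surj)
  have "word_prod m L (translate_word a (t g)) = L y * word_prod m L (translate_word a g)"
    if rep: "representation n G f m L" and g: "g \<in> translates n G" for m L g
  proof -
    note L = representationD[OF rep]
    obtain i x where gix: "g = (i, x)" by fastforce
    have i: "i < n - 1" and x: "x \<in> G" using g gix by (auto simp: translates_def)
    have Lc: "L (c x) = word_prod m L (y # x # replicate (n - 2) a)"
      unfolding c_def using x y a len by (intro L) auto
    have La: "word_prod m L (replicate j a) \<in> carrier_mat m m" for j
      using L(2)[OF a] by (intro word_prod_carrier) auto
    show ?thesis
    proof (cases "i = n - 2")
      case True
      have "L (c x) * 1\<^sub>m m = L (c x)" using L(2)[OF cG[OF x]] by simp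
      then show ?thesis using True Lc gix by (simp add: t_def translate_word_def)
    next
      case False
      \<comment> \<open>\<open>j\<close> is the number of letters \<open>a\<close> that bring both
        words of length \<open>i + 2\<close> up to length \<open>n\<close>. The two padded products
        equal \<open>L (c x)\<close>, and the common factor \<open>L a\<close> to the power
        \<open>j\<close> is then cancelled on the right.\<close>
      define j where "j = n - 2 - i"
      have j: "n - 1 = Suc i + j" "n - 2 = i + j" using i False unfolding j_def by auto
      have set: "set (h x # replicate (Suc i) a) \<subseteq> G" "set (y # x # replicate i a) \<subseteq> G"
        using h x y a by auto
      have "word_prod m L (h x # replicate (Suc i) a) * word_prod m L (replicate j a)
          = word_prod m L (h x # replicate (n - 1) a)"
        using L(2) set a unfolding j replicate_add
        by (subst word_prod_append[symmetric]) auto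
      also have "\<dots> = L (f (h x # replicate (n - 1) a))"
        using h x a len by (intro L(4)[symmetric]) auto
      also have "\<dots> = word_prod m L (y # x # replicate (n - 2) a)"
        using h(2)[OF x] Lc by simp
      also have "\<dots> = word_prod m L (y # x # replicate i a) * word_prod m L (replicate j a)"
        using L(2) set a unfolding j replicate_add
        by (subst word_prod_append[symmetric]) auto
      finally have eq: "word_prod m L (h x # replicate (Suc i) a) * word_prod m L (replicate j a)
        = word_prod m L (y # x # replicate i a) * word_prod m L (replicate j a)" .
      obtain B where B: "B \<in> carrier_mat m m" "word_prod m L (replicate j a) * B = 1\<^sub>m m"
        by (rule word_prod_inverse[of "replicate j a" L m]) (use L(2,3) a in auto)
      have "word_prod m L (h x # replicate (Suc i) a) = word_prod m L (y # x # replicate i a)"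
        by (rule mat_mult_right_cancel[where r = m, OF _ _ La B eq]) (use L(2) set in \<open>auto intro!: word_prod_carrier simp del: word_prod_simps\<close>)
      then show ?thesis using False gix by (simp add: t_def translate_word_def)
    qed
  qed
  with bij that show ?thesis by blast
qed

section \<open>Inverses of words and the invariant form\<close>

lemma word_inverse:
  assumes rep: "representation n G f m L" and xs: "set xs \<subseteq> G"
  obtains B where "B \<in> carrier_mat m m" "word_prod m L xs * B = 1\<^sub>m m" "B * word_prod m L xs = 1\<^sub>m m"
  by (rule word_prod_inverse[of xs L m]) (use representationD[OF rep] xs in auto)

lemma word_carrier:
  assumes rep: "representation n G f m L" and xs: "set xs \<subseteq> G"
  shows "word_prod m L xs \<in> carrier_mat m m"
  by (rule word_prod_carrier) (use representationD[OF rep] xs in auto)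

text \<open>The form is the sum of \<open>E g * conj_transpose (E g)\<close> over all translates.
  Left translation by \<open>y\<close> permutes the translates, which makes the sum invariant;
  positivity makes it nonzero, and Schur's lemma then makes it invertible.\<close>

lemma invariant_form:
  assumes fin: "finite G" and irr: "irreducible_rep n G f k K"
  obtains H R where "H \<in> carrier_mat k k" "R \<in> carrier_mat k k" "H * R = 1\<^sub>m k" "R * H = 1\<^sub>m k"
    "\<And>y. y \<in> G \<Longrightarrow> K y * H * conj_transpose (K y) = H"
proof -
  note rep = irreducible_rep_representation[OF irr]
  note K = representationD[OF rep]
  obtain a where a: "a \<in> G" using nonempty by blast
  define I where "I = translates n G"
  define E where "E g = word_prod k K (translate_word a g)" for g
  have E: "E g \<in> carrier_mat k k" if "g \<in> I" for g
    unfolding E_def using that a by (intro word_carrier[OF rep] translate_word_set) (auto simp: I_def)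
  define F where "F g = E g * conj_transpose (E g)" for g
  have F: "F g \<in> carrier_mat k k" if "g \<in> I" for g using E[OF that] by (simp add: F_def mult_carrier_mat[of _ k k])
  define H where "H = mat_sum k k F I"
  have H: "H \<in> carrier_mat k k" by (simp add: H_def)
  have "\<exists>B. B \<in> carrier_mat k k \<and> K y * B = 1\<^sub>m k \<and> B * K y = 1\<^sub>m k" if "y \<in> G" for y
    using invertible_mat_obtain[OF K(2)[OF that] K(3)[OF that]] by metis
  then obtain J where J: "\<And>y. y \<in> G \<Longrightarrow> J y \<in> carrier_mat k k"
    "\<And>y. y \<in> G \<Longrightarrow> K y * J y = 1\<^sub>m k" "\<And>y. y \<in> G \<Longrightarrow> J y * K y = 1\<^sub>m k" by metis
  \<comment> \<open>Invariance rewritten with the inverse \<open>J y\<close> of \<open>K y\<close>,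
    so that it becomes an intertwining relation to which Schur's lemma applies.\<close>
  have inter: "K y * H = H * conj_transpose (J y)" if y: "y \<in> G" for y
  proof -
    obtain t where t: "bij_betw t I I" "\<And>g. g \<in> I \<Longrightarrow> E (t g) = K y * E g"
      using left_translation[OF fin a y] rep unfolding I_def E_def by metis
    have "F (t g) * conj_transpose (J y) = K y * F g" if g: "g \<in> I" for g
    proof -
      note c = E[OF g] K(2)[OF y] J(1)[OF y]
      have cc: "conj_transpose (E g) \<in> carrier_mat k k" "conj_transpose (K y) \<in> carrier_mat k k"
        "conj_transpose (J y) \<in> carrier_mat k k" using c by simp_all
      have "F (t g) * conj_transpose (J y)
          = (K y * E g) * (conj_transpose (E g) * conj_transpose (K y)) * conj_transpose (J y)"
        unfolding F_def t(2)[OF g] using c by (simp add: conj_transpose_mult[of _ k k _ k])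
      also have "\<dots> = K y * (E g * conj_transpose (E g)) * (conj_transpose (K y) * conj_transpose (J y))"
        using c cc by (simp add: assoc_mult_mat[of _ k k _ k _ k] mult_carrier_mat[of _ k k])
      also have "conj_transpose (K y) * conj_transpose (J y) = 1\<^sub>m k"
        using conj_transpose_mult[OF c(3,2)] J(3)[OF y] by simp
      also have "K y * (E g * conj_transpose (E g)) * 1\<^sub>m k = K y * F g"
        using c cc by (simp add: F_def mult_carrier_mat[of _ k k] right_mult_one_mat[of _ k k])
      finally show ?thesis .
    qed
    then show ?thesis
      unfolding H_def using mat_sum_intertwine[OF t(1) F, where X = "conj_transpose (J y)" and Y = "K y"] K(2)[OF y] J(1)[OF y]
      by simp
  qed
  have "H \<noteq> 0\<^sub>m k k"
  proof
    assume H0: "H = 0\<^sub>m k k"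
    have k: "0 < k" using K(1) by simp
    \<comment> \<open>Some translate is needed: if \<open>H\<close> were zero, the first row of the
      invertible matrix \<open>E g\<close> would vanish.\<close>
    define g where "g = (0 :: nat, a)"
    have g: "g \<in> I" using a arity by (auto simp: I_def g_def translates_def)
    have finI: "finite I" using fin by (simp add: I_def translates_def)
    \<comment> \<open>The corner entry of \<open>E h\<close> times its conjugate transpose is the
      squared norm of the first row of \<open>E h\<close>.\<close>
    have Fd: "F h $$ (0, 0) = of_real (\<Sum>w<k. (cmod (E h $$ (0, w)))\<^sup>2)" if h: "h \<in> I" for h
    proof -
      have "F h $$ (0, 0) = (\<Sum>w<k. E h $$ (0, w) * cnj (E h $$ (0, w)))"
        unfolding F_def using E[OF h] k
        by (subst mult_mat_index[of _ k k _ k]) (auto simp: conj_transpose_def)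
      then show ?thesis by (simp only: of_real_sum complex_norm_square)
    qed
    have "(\<Sum>h\<in>I. F h $$ (0, 0)) = 0"
      using H0 k mat_sum_index[of 0 k 0 k F I] by (simp add: H_def)
    then have "of_real (\<Sum>h\<in>I. \<Sum>w<k. (cmod (E h $$ (0, w)))\<^sup>2) = (0 :: complex)"
      using Fd by simp
    then have "(\<Sum>h\<in>I. \<Sum>w<k. (cmod (E h $$ (0, w)))\<^sup>2) = 0"
      by (simp only: of_real_eq_0_iff)
    then have "(\<Sum>w<k. (cmod (E g $$ (0, w)))\<^sup>2) = 0"
      using finI g by (subst (asm) sum_nonneg_eq_0_iff) (auto intro: sum_nonneg)
    then have z: "E g $$ (0, w) = 0" if "w < k" for w
      using that by (subst (asm) sum_nonneg_eq_0_iff) auto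
    obtain B where B: "B \<in> carrier_mat k k" "E g * B = 1\<^sub>m k"
      using word_inverse[OF rep translate_word_set[OF a]] g unfolding I_def E_def by metis
    have "(E g * B) $$ (0, 0) = 0"
      using mult_mat_index[OF E[OF g] B(1), of 0 0] z k by simp
    then show False using B k by simp
  qed
  then obtain R where R: "R \<in> carrier_mat k k" "H * R = 1\<^sub>m k"
    using schur_right_inverse[OF irr H, of "\<lambda>y. conj_transpose (J y)"] inter J(1) by auto
  have "R * H = 1\<^sub>m k" by (rule mat_mult_left_right_inverse[OF H R])
  moreover have "K y * H * conj_transpose (K y) = H" if y: "y \<in> G" for y
  proof -
    have c: "conj_transpose (J y) \<in> carrier_mat k k" "conj_transpose (K y) \<in> carrier_mat k k"
      using J(1)[OF y] K(2)[OF y] by simp_all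
    have "conj_transpose (J y) * conj_transpose (K y) = 1\<^sub>m k"
      using conj_transpose_mult[OF K(2)[OF y] J(1)[OF y]] J(2)[OF y] by simp
    then show ?thesis using inter[OF y] H c by (simp add: assoc_mult_mat[of _ k k _ k _ k])
  qed
  ultimately show ?thesis using that[OF H R(1,2)] by blast
qed

text \<open>Takes the place of unitarity. For the product \<open>W\<close> of the word, invariance
  of \<open>H\<close> gives \<open>B * H = H * conj_transpose W\<close>, so \<open>B\<close> is
  similar to the conjugate transpose of \<open>W\<close>.\<close>

lemma mat_trace_word_inverse:
  assumes fin: "finite G" and irr: "irreducible_rep n G f k K" and xs: "set xs \<subseteq> G"
    and B: "B \<in> carrier_mat k k" "B * word_prod k K xs = 1\<^sub>m k"
  shows "mat_trace B = cnj (mat_trace (word_prod k K xs))"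
proof -
  note rep = irreducible_rep_representation[OF irr]
  note K = representationD[OF rep]
  obtain H R where H: "H \<in> carrier_mat k k" "R \<in> carrier_mat k k" "H * R = 1\<^sub>m k" "R * H = 1\<^sub>m k"
    and inv: "\<And>y. y \<in> G \<Longrightarrow> K y * H * conj_transpose (K y) = H"
    using invariant_form[OF fin irr] by metis
  \<comment> \<open>Invariance passes from letters to words: the inner word already fixes
    \<open>H\<close>, and the new first letter fixes it again.\<close>
  have "word_prod k K xs * H * conj_transpose (word_prod k K xs) = H"
    using xs
  proof (induction xs)
    case Nil
    then show ?case using H by simp
  next
    case (Cons x xs)
    have x: "x \<in> G" and xs: "set xs \<subseteq> G" using Cons by auto
    note Kx = K(2)[OF x] and W = word_carrier[OF rep xs]
    have c: "conj_transpose (K x) \<in> carrier_mat k k" "conj_transpose (word_prod k K xs) \<in> carrier_mat k k"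
      using Kx W by simp_all
    have "K x * word_prod k K xs * H * conj_transpose (K x * word_prod k K xs)
        = K x * (word_prod k K xs * H * conj_transpose (word_prod k K xs)) * conj_transpose (K x)"
      using Kx W c H(1) by (simp add: conj_transpose_mult[of _ k k _ k] assoc_mult_mat[of _ k k _ k _ k] mult_carrier_mat[of _ k k])
    then show ?case using Cons xs inv[OF x] by simp
  qed
  note form = this
  define W where "W = word_prod k K xs"
  have W: "W \<in> carrier_mat k k" unfolding W_def by (rule word_carrier[OF rep xs])
  then have c: "conj_transpose W \<in> carrier_mat k k" by simp
  have "B * H = B * (W * H * conj_transpose W)" using form by (simp add: W_def)
  also have "\<dots> = (B * W) * (H * conj_transpose W)"
    using B(1) W H(1) c by (simp add: assoc_mult_mat[of _ k k _ k _ k] mult_carrier_mat[of _ k k])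
  also have "\<dots> = H * conj_transpose W" using B(2) H(1) c by (simp add: W_def mult_carrier_mat[of _ k k])
  finally have BH: "B * H = H * conj_transpose W" .
  have "mat_trace B = mat_trace (B * H * R)"
    using B(1) H by (simp add: assoc_mult_mat[of _ k k _ k _ k])
  also have "\<dots> = mat_trace (R * (H * conj_transpose W))"
    unfolding BH using H c by (intro mat_trace_mult_comm[of _ k k]) (auto simp: mult_carrier_mat[of _ k k])
  also have "R * (H * conj_transpose W) = conj_transpose W"
    using H c assoc_mult_mat[of R k k H k "conj_transpose W" k] by simp
  finally show ?thesis using mat_trace_conj_transpose[OF W] by (simp add: W_def)
qed

end

section \<open>Matrix units and scalar intertwiners\<close>

definition mat_unit :: "nat \<Rightarrow> nat \<Rightarrow> nat \<Rightarrow> nat \<Rightarrow> complex mat" where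
  "mat_unit m k j l = mat m k (\<lambda>(u, v). if u = j \<and> v = l then 1 else 0)"

lemma mat_unit_carrier [simp]: "mat_unit m k j l \<in> carrier_mat m k"
  by (simp add: mat_unit_def)

lemma mult_mat_unit_mult_index:
  assumes "A \<in> carrier_mat r m" "B \<in> carrier_mat k c" "j < m" "l < k" "u < r" "v < c"
  shows "(A * mat_unit m k j l * B) $$ (u, v) = A $$ (u, j) * B $$ (l, v)"
proof -
  have AU: "(A * mat_unit m k j l) $$ (u, w) = (if w = l then A $$ (u, j) else 0)" if "w < k" for w
  proof -
    have "(A * mat_unit m k j l) $$ (u, w) = (\<Sum>i<m. A $$ (u, i) * (if i = j \<and> w = l then 1 else 0))"
      using assms that by (subst mult_mat_index[of _ r m _ k]) (auto simp: mat_unit_def)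
    also have "\<dots> = (\<Sum>i<m. if i = j then (if w = l then A $$ (u, j) else 0) else 0)"
      by (intro sum.cong) auto
    finally show ?thesis using assms(3) by simp
  qed
  have "A * mat_unit m k j l \<in> carrier_mat r k" using assms(1) by (simp add: mult_carrier_mat[of _ r m])
  then have "(A * mat_unit m k j l * B) $$ (u, v)
      = (\<Sum>w<k. (A * mat_unit m k j l) $$ (u, w) * B $$ (w, v))"
    using assms by (intro mult_mat_index)
  also have "\<dots> = (\<Sum>w<k. if w = l then A $$ (u, j) * B $$ (l, v) else 0)"
    by (intro sum.cong) (auto simp: AU)
  finally show ?thesis using assms(4) by simp
qed

text \<open>The product of the diagonal entries \<open>j\<close> of \<open>A g\<close> and
  \<open>l\<close> of \<open>B g\<close> is the entry \<open>(j, l)\<close> of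
  \<open>A g * mat_unit m k j l * B g\<close>. A sum of products of traces thus becomes a sum of
  entries of averaged matrices.\<close>

lemma sum_mat_trace_mult:
  assumes A: "\<And>g. g \<in> I \<Longrightarrow> A g \<in> carrier_mat m m" and B: "\<And>g. g \<in> I \<Longrightarrow> B g \<in> carrier_mat k k"
  shows "(\<Sum>g\<in>I. mat_trace (A g) * mat_trace (B g)) =
    (\<Sum>j<m. \<Sum>l<k. mat_sum m k (\<lambda>g. A g * mat_unit m k j l * B g) I $$ (j, l))"
proof -
  have "(\<Sum>j<m. \<Sum>l<k. mat_sum m k (\<lambda>g. A g * mat_unit m k j l * B g) I $$ (j, l))
      = (\<Sum>j<m. \<Sum>l<k. \<Sum>g\<in>I. A g $$ (j, j) * B g $$ (l, l))"
    by (auto intro!: sum.cong simp: mat_sum_index mult_mat_unit_mult_index[OF A B])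
  also have "\<dots> = (\<Sum>j<m. \<Sum>g\<in>I. \<Sum>l<k. A g $$ (j, j) * B g $$ (l, l))"
    by (intro sum.cong refl sum.swap)
  also have "\<dots> = (\<Sum>g\<in>I. \<Sum>j<m. \<Sum>l<k. A g $$ (j, j) * B g $$ (l, l))"
    by (rule sum.swap)
  also have "\<dots> = (\<Sum>g\<in>I. mat_trace (A g) * mat_trace (B g))"
    by (intro sum.cong) (auto simp: mat_trace_alt[OF A] mat_trace_alt[OF B] sum_product)
  finally show ?thesis by simp
qed

text \<open>For an eigenvalue \<open>c\<close> of \<open>S\<close>, the matrix
  \<open>S - c 1\<close> commutes with \<open>L\<close> and kills an eigenvector. By
  \<open>schur_injective\<close> it must be zero.\<close>

lemma schur_scalar:
  assumes irr: "irreducible_rep n G f m L" and S: "S \<in> carrier_mat m m"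
    and LS: "\<And>y. y \<in> G \<Longrightarrow> L y * S = S * L y"
  obtains c where "S = c \<cdot>\<^sub>m 1\<^sub>m m"
proof -
  note L = representationD[OF irreducible_rep_representation[OF irr]]
  obtain c where "c \<in> spectrum S" using spectrum_non_empty[OF S] L(1) by auto
  then obtain v where v: "v \<in> carrier_vec m" "v \<noteq> 0\<^sub>v m" "S *\<^sub>v v = c \<cdot>\<^sub>v v"
    using S by (auto simp: spectrum_def eigenvalue_def eigenvector_def)
  define T where "T = S - c \<cdot>\<^sub>m 1\<^sub>m m"
  have T: "T \<in> carrier_mat m m"
    unfolding T_def by (intro minus_carrier_mat) simp
  have LT: "L y * T = T * L y" if y: "y \<in> G" for y
  proof -
    note Ly = L(2)[OF y]
    have "L y * T = L y * S - c \<cdot>\<^sub>m L y"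
      unfolding T_def using Ly S by (subst mult_minus_distrib_mat[of _ m m _ m])
        (auto simp: mult_smult_distrib[of _ m m _ m])
    moreover have "T * L y = S * L y - c \<cdot>\<^sub>m L y"
      unfolding T_def using Ly S by (subst minus_mult_distrib_mat[of _ m m _ _ m])
        (auto simp: mult_smult_assoc_mat[of _ m m _ m])
    ultimately show ?thesis using LS[OF y] by simp
  qed
  have "T *\<^sub>v v = S *\<^sub>v v - (c \<cdot>\<^sub>m 1\<^sub>m m) *\<^sub>v v"
    unfolding T_def using S v by (intro minus_mult_distrib_mat_vec[of _ m m]) auto
  also have "(c \<cdot>\<^sub>m 1\<^sub>m m) *\<^sub>v v = c \<cdot>\<^sub>v v"
    using v(1) by (intro eq_vecI) auto
  finally have "T *\<^sub>v v = 0\<^sub>v m" using v by simp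
  then have "T = 0\<^sub>m m m" using schur_injective[OF irr T _ L(2) LT v(1)] v(2) by blast
  then have "S = c \<cdot>\<^sub>m 1\<^sub>m m"
  proof -
    assume T0: "T = 0\<^sub>m m m"
    have "S $$ (i, j) = (c \<cdot>\<^sub>m 1\<^sub>m m) $$ (i, j)" if "i < m" "j < m" for i j
    proof -
      have "T $$ (i, j) = 0" using T0 that by simp
      then show ?thesis using that S by (simp add: T_def)
    qed
    then show ?thesis using S by (intro eq_matI) auto
  qed
  then show ?thesis by (rule that)
qed

subsection \<open>Orthogonality\<close>

text \<open>For representations of a finite polyadic group this is, up to the factor
  \<open>(n - 1) * card G\<close>, the inner product of two characters of the covering group, whose
  elements are listed as \<open>x a^i\<close>.\<close>

definition char_pairing ::
  "nat \<Rightarrow> 'a set \<Rightarrow> 'a \<Rightarrow> nat \<Rightarrow> ('a \<Rightarrow> complex mat) \<Rightarrow> nat \<Rightarrow> ('a \<Rightarrow> complex mat) \<Rightarrow> complex" where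
  "char_pairing n G a m L k K = (\<Sum>g\<in>translates n G.
     mat_trace (word_prod m L (translate_word a g)) *
     cnj (mat_trace (word_prod k K (translate_word a g))))"

context polyadic_group
begin

text \<open>\<open>S j l\<close> averages the matrix unit at \<open>(j, l)\<close> over all
  translates, multiplied by \<open>D g\<close> on the left and the inverse of \<open>E g\<close> on
  the right. Since the trace of that inverse is the conjugate trace of \<open>E g\<close>, the
  pairing is a sum of entries of these averages.\<close>

lemma char_pairing_intertwiners:
  assumes fin: "finite G" and a: "a \<in> G"
    and L: "irreducible_rep n G f m L" and K: "irreducible_rep n G f k K"
  obtains S where "\<And>j l. S j l \<in> carrier_mat m k"
    "\<And>j l y. y \<in> G \<Longrightarrow> L y * S j l = S j l * K y"
    "char_pairing n G a m L k K = (\<Sum>j<m. \<Sum>l<k. S j l $$ (j, l))"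
    "\<And>j l. L = K \<Longrightarrow> m = k \<Longrightarrow> j < m \<Longrightarrow> l < m \<Longrightarrow>
       mat_trace (S j l) = (if j = l then of_nat (card (translates n G)) else 0)"
proof -
  note repL = irreducible_rep_representation[OF L] and repK = irreducible_rep_representation[OF K]
  note Lc = representationD(2)[OF repL] and Kc = representationD(2)[OF repK]
  define I where "I = translates n G"
  define D where "D g = word_prod m L (translate_word a g)" for g
  define E where "E g = word_prod k K (translate_word a g)" for g
  have sub: "set (translate_word a g) \<subseteq> G" if "g \<in> I" for g
    using translate_word_set[OF a] that by (simp add: I_def)
  have D: "D g \<in> carrier_mat m m" if "g \<in> I" for g
    unfolding D_def by (rule word_carrier[OF repL sub[OF that]])
  have E: "E g \<in> carrier_mat k k" if "g \<in> I" for g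
    unfolding E_def by (rule word_carrier[OF repK sub[OF that]])
  have "\<exists>B. B \<in> carrier_mat k k \<and> E g * B = 1\<^sub>m k \<and> B * E g = 1\<^sub>m k" if "g \<in> I" for g
    unfolding E_def using word_inverse[OF repK sub[OF that]] by metis
  then obtain J where J: "\<And>g. g \<in> I \<Longrightarrow> J g \<in> carrier_mat k k"
    "\<And>g. g \<in> I \<Longrightarrow> E g * J g = 1\<^sub>m k" "\<And>g. g \<in> I \<Longrightarrow> J g * E g = 1\<^sub>m k" by metis
  have JE: "mat_trace (J g) = cnj (mat_trace (E g))" if "g \<in> I" for g
    unfolding E_def
    by (rule mat_trace_word_inverse[OF fin K sub[OF that] J(1)[OF that]])
      (use J(3)[OF that] in \<open>simp add: E_def\<close>)
  define S where "S j l = mat_sum m k (\<lambda>g. D g * mat_unit m k j l * J g) I" for j l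
  have F: "D g * mat_unit m k j l * J g \<in> carrier_mat m k" if "g \<in> I" for g j l
    using D[OF that] J(1)[OF that] by (auto intro!: mult_carrier_mat)
  have inter: "L y * S j l = S j l * K y" if y: "y \<in> G" for y j l
  proof -
    obtain t where t: "bij_betw t I I" "\<And>g. g \<in> I \<Longrightarrow> D (t g) = L y * D g"
      "\<And>g. g \<in> I \<Longrightarrow> E (t g) = K y * E g"
      using left_translation[OF fin a y] repL repK unfolding I_def E_def D_def by metis
    have "D (t g) * mat_unit m k j l * J (t g) * K y = L y * (D g * mat_unit m k j l * J g)"
      if g: "g \<in> I" for g
    proof -
      have tg: "t g \<in> I" using t(1) g by (metis bij_betwE)
      \<comment> \<open>Inserting \<open>E g * J g\<close>, the identity, lets
        \<open>K y * E g\<close> be recognised as \<open>E (t g)\<close>, which cancels against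
        \<open>J (t g)\<close>.\<close>
      have "J (t g) * K y = J (t g) * K y * (E g * J g)"
        using J(1)[OF tg] Kc[OF y] J(2)[OF g] by (simp add: mult_carrier_mat[of _ k k])
      also have "\<dots> = J (t g) * E (t g) * J g"
        unfolding t(3)[OF g] using J(1)[OF tg] Kc[OF y] E[OF g] J(1)[OF g]
        by (simp add: assoc_mult_mat[of _ k k _ k _ k] mult_carrier_mat[of _ k k])
      also have "\<dots> = J g" using J(3)[OF tg] J(1)[OF g] by simp
      finally have JK: "J (t g) * K y = J g" .
      have "D (t g) * mat_unit m k j l * J (t g) * K y = D (t g) * mat_unit m k j l * (J (t g) * K y)"
        using D[OF tg] J(1)[OF tg] Kc[OF y] by (intro assoc_mult_mat[of _ m k _ k _ k]) (auto intro!: mult_carrier_mat)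
      also have "\<dots> = L y * D g * mat_unit m k j l * J g" by (simp add: JK t(2)[OF g])
      also have "\<dots> = L y * (D g * mat_unit m k j l * J g)"
        using Lc[OF y] D[OF g] J(1)[OF g]
        by (simp add: assoc_mult_mat[of _ m m _ m _ k] assoc_mult_mat[of _ m m _ k _ k] mult_carrier_mat[of _ m m])
      finally show ?thesis .
    qed
    then show ?thesis
      unfolding S_def using mat_sum_intertwine[OF t(1) F Kc[OF y] Lc[OF y]] by simp
  qed
  have pair: "char_pairing n G a m L k K = (\<Sum>j<m. \<Sum>l<k. S j l $$ (j, l))"
  proof -
    have "char_pairing n G a m L k K = (\<Sum>g\<in>I. mat_trace (D g) * mat_trace (J g))"
      unfolding char_pairing_def I_def[symmetric] D_def[symmetric] E_def[symmetric]
      by (intro sum.cong) (simp_all add: JE)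
    then show ?thesis unfolding S_def using sum_mat_trace_mult[of I D m J k] D J(1) by simp
  qed
  have tr: "mat_trace (S j l) = (if j = l then of_nat (card I) else 0)"
    if eq: "L = K" "m = k" and jl: "j < m" "l < m" for j l
  proof -
    have DE: "D = E" using eq by (auto simp: D_def E_def)
    have "mat_trace (S j l) = (\<Sum>u<m. \<Sum>g\<in>I. (D g * mat_unit m k j l * J g) $$ (u, u))"
      using eq by (subst mat_trace_alt[of _ m]) (auto simp: S_def mat_sum_index)
    also have "\<dots> = (\<Sum>g\<in>I. mat_trace (D g * mat_unit m k j l * J g))"
    proof (subst sum.swap, intro sum.cong refl)
      fix g assume g: "g \<in> I"
      show "(\<Sum>u<m. (D g * mat_unit m k j l * J g) $$ (u, u)) = mat_trace (D g * mat_unit m k j l * J g)"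
        using F[OF g, of j l] eq by (intro mat_trace_alt[symmetric]) auto
    qed
    also have "\<dots> = (\<Sum>g\<in>I. (if j = l then 1 else 0))"
    proof (intro sum.cong refl)
      fix g assume g: "g \<in> I"
      have U: "mat_unit k k j l \<in> carrier_mat k k" by simp
      \<comment> \<open>Cyclicity of the trace brings \<open>J g\<close> next to \<open>E g\<close>,
        leaving the trace of a matrix unit.\<close>
      have "mat_trace (E g * mat_unit k k j l * J g) = mat_trace (J g * (E g * mat_unit k k j l))"
        using E[OF g] J(1)[OF g] by (intro mat_trace_mult_comm[of _ k k]) (auto simp: mult_carrier_mat[of _ k k])
      also have "J g * (E g * mat_unit k k j l) = mat_unit k k j l"
        using assoc_mult_mat[OF J(1)[OF g] E[OF g] U] J(3)[OF g] left_mult_one_mat[OF U] by simp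
      also have "mat_trace (mat_unit k k j l) = (\<Sum>u<k. if u = j then (if j = l then 1 else 0) else 0)"
        by (subst mat_trace_alt[of _ k]) (auto simp: mat_unit_def intro!: sum.cong)
      also have "\<dots> = (if j = l then 1 else 0)" using jl eq by simp
      finally show "mat_trace (D g * mat_unit m k j l * J g) = (if j = l then 1 else 0)"
        using eq DE by simp
    qed
    finally show ?thesis by simp
  qed
  show ?thesis
    by (rule that[of S]) (use inter pair tr in \<open>auto simp: S_def I_def\<close>)
qed

text \<open>A nonzero pairing forces a nonzero entry in some \<open>S j l\<close>, and by Schur's
  lemma that intertwiner is an equivalence.\<close>

lemma char_pairing_nonzero:
  assumes fin: "finite G" and a: "a \<in> G"
    and L: "irreducible_rep n G f m L" and K: "irreducible_rep n G f k K"
    and nz: "char_pairing n G a m L k K \<noteq> 0"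
  obtains S R where "S \<in> carrier_mat m k" "R \<in> carrier_mat k m" "S * R = 1\<^sub>m m" "R * S = 1\<^sub>m k"
    "\<And>y. y \<in> G \<Longrightarrow> L y * S = S * K y"
proof -
  obtain S where S: "\<And>j l. S j l \<in> carrier_mat m k"
    "\<And>j l y. y \<in> G \<Longrightarrow> L y * S j l = S j l * K y"
    "char_pairing n G a m L k K = (\<Sum>j<m. \<Sum>l<k. S j l $$ (j, l))"
    by (rule char_pairing_intertwiners[OF fin a L K]) blast
  have "\<exists>j<m. \<exists>l<k. S j l $$ (j, l) \<noteq> 0"
  proof (rule ccontr)
    assume "\<not> ?thesis"
    then have "(\<Sum>j<m. \<Sum>l<k. S j l $$ (j, l)) = 0" by (intro sum.neutral) auto
    then show False using nz S(3) by simp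
  qed
  then obtain j l where jl: "j < m" "l < k" "S j l $$ (j, l) \<noteq> 0" by blast
  then have "S j l \<noteq> 0\<^sub>m m k" by auto
  then obtain R where "R \<in> carrier_mat k m" "S j l * R = 1\<^sub>m m" "R * S j l = 1\<^sub>m k"
    using schur_invertible[OF L K S(1) _ S(2)] by blast
  then show ?thesis using that[OF S(1)] S(2) by blast
qed

text \<open>Each \<open>S j l\<close> is scalar by Schur's lemma, and its trace determines the
  scalar: the number of translates divided by \<open>m\<close> if \<open>j = l\<close>, and 0
  otherwise. The \<open>m\<close> diagonal contributions add up to the number of translates.\<close>

lemma char_pairing_self:
  assumes fin: "finite G" and a: "a \<in> G" and L: "irreducible_rep n G f m L"
  shows "char_pairing n G a m L m L = of_nat (card (translates n G))"
proof -
  let ?N = "of_nat (card (translates n G)) :: complex"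
  obtain S where S: "\<And>j l. S j l \<in> carrier_mat m m"
    "\<And>j l y. y \<in> G \<Longrightarrow> L y * S j l = S j l * L y"
    "char_pairing n G a m L m L = (\<Sum>j<m. \<Sum>l<m. S j l $$ (j, l))"
    "\<And>j l. j < m \<Longrightarrow> l < m \<Longrightarrow> mat_trace (S j l) = (if j = l then ?N else 0)"
    by (rule char_pairing_intertwiners[OF fin a L L]) blast
  have m: "m > 0" using representationD(1)[OF irreducible_rep_representation[OF L]] by simp
  have "S j l $$ (j, l) = (if l = j then ?N / of_nat m else 0)" if jl: "j < m" "l < m" for j l
  proof -
    obtain c where c: "S j l = c \<cdot>\<^sub>m 1\<^sub>m m" using schur_scalar[OF L S(1,2)] by metis
    then have "c * of_nat m = (if j = l then ?N else 0)"
      using S(4)[OF jl] mat_trace_smult[OF one_carrier_mat, of c m] by simp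
    then show ?thesis using c jl m by (auto simp: field_simps)
  qed
  then have "char_pairing n G a m L m L = (\<Sum>j<m. \<Sum>l<m. if l = j then ?N / of_nat m else 0)"
    unfolding S(3) by (intro sum.cong) auto
  also have "\<dots> = ?N" using m by simp
  finally show ?thesis .
qed

text \<open>The letters \<open>p\<close> fill the word \<open>x a^i\<close> up to length
  \<open>n\<close>, so that \<open>f\<close> applies, and act as the identity matrix.\<close>

lemma rep_character_translate:
  assumes rep: "representation n G f m L" and p: "p \<in> G" "L p = 1\<^sub>m m"
    and a: "a \<in> G" and x: "x \<in> G" and i: "i \<le> n - 2"
  shows "rep_character G L (f ([x] @ replicate i a @ replicate (n - i - 1) p)) =
    mat_trace (word_prod m L (translate_word a (i, x)))"
proof -
  let ?w = "[x] @ replicate i a @ replicate (n - i - 1) p"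
  have w: "length ?w = n" "set ?w \<subseteq> G" using assms arity by auto
  have "word_prod m L ?w = word_prod m L ([x] @ replicate i a) * word_prod m L (replicate (n - i - 1) p)"
    unfolding append_assoc[symmetric]
    by (rule word_prod_append) (use representationD(2)[OF rep] x a p in auto)
  also have "\<dots> = word_prod m L ([x] @ replicate i a) * 1\<^sub>m m"
    using p(2) by (simp only: word_prod_replicate_one)
  also have "\<dots> = word_prod m L ([x] @ replicate i a)"
    by (rule right_mult_one_mat[OF word_carrier[OF rep, of "[x] @ replicate i a"]]) (use x a in auto)
  finally have "word_prod m L ?w = word_prod m L (translate_word a (i, x))"
    by (simp add: translate_word_def)
  then show ?thesis
    using closed[OF w] representationD(4)[OF rep w] by (simp add: rep_character_def)
qed

lemma mat_trace_word_similar: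
  assumes L: "representation n G f m L" and K: "representation n G f k K" and xs: "set xs \<subseteq> G"
    and S: "S \<in> carrier_mat m k" "R \<in> carrier_mat k m" "S * R = 1\<^sub>m m" "R * S = 1\<^sub>m k"
    and LS: "\<And>y. y \<in> G \<Longrightarrow> L y * S = S * K y"
  shows "mat_trace (word_prod m L xs) = mat_trace (word_prod k K xs)"
proof -
  note c = word_carrier[OF L xs] word_carrier[OF K xs]
  have "word_prod m L xs * S = S * word_prod k K xs"
    by (rule word_prod_intertwine[OF S(1)])
      (use xs representationD(2)[OF L] representationD(2)[OF K] LS in auto)
  then have "R * (word_prod m L xs * S) = R * S * word_prod k K xs"
    using assoc_mult_mat[OF S(2,1) c(2)] by simp
  then have "word_prod k K xs = R * (word_prod m L xs * S)"
    using S(4) c(2) by simp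
  then have "mat_trace (word_prod k K xs) = mat_trace (word_prod m L xs * S * R)"
    using mat_trace_mult_comm[OF S(2) mult_carrier_mat[OF c(1) S(1)]] by simp
  also have "word_prod m L xs * S * R = word_prod m L xs"
    using assoc_mult_mat[OF c(1) S(1,2)] S(3) c(1) by simp
  finally show ?thesis by simp
qed

text \<open>The word \<open>x a^i\<close> has \<open>i + 1\<close> letters, so the twist multiplies
  its trace by \<open>z * z ^ i\<close>. Taking one factor \<open>z\<close> out leaves a polynomial
  of degree at most \<open>n - 2\<close> whose coefficients do not depend on
  \<open>z\<close>.\<close>

lemma char_pairing_twist:
  assumes L: "representation n G f m L" and a: "a \<in> G"
  shows "char_pairing n G a m (\<lambda>x. z \<cdot>\<^sub>m L x) k K =
    z * (\<Sum>i\<le>n - 2. (\<Sum>x\<in>G. mat_trace (word_prod m L (translate_word a (i, x))) *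
      cnj (mat_trace (word_prod k K (translate_word a (i, x))))) * z ^ i)"
proof -
  have *: "mat_trace (word_prod m (\<lambda>x. z \<cdot>\<^sub>m L x) (translate_word a (i, x))) =
      z * z ^ i * mat_trace (word_prod m L (translate_word a (i, x)))" if "x \<in> G" for i x
  proof -
    have sub: "set (translate_word a (i, x)) \<subseteq> G" using a that by (auto simp: translate_word_def)
    have "length (translate_word a (i, x)) = Suc i" by (simp add: translate_word_def)
    then have "word_prod m (\<lambda>x. z \<cdot>\<^sub>m L x) (translate_word a (i, x)) =
        (z * z ^ i) \<cdot>\<^sub>m word_prod m L (translate_word a (i, x))"
      using word_prod_smult[of "translate_word a (i, x)" L m z] representationD(2)[OF L] sub by auto
    then show ?thesis using mat_trace_smult[OF word_carrier[OF L sub]] by simp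
  qed
  have "{..<n - 1} = {..n - 2}" using arity by auto
  then have "char_pairing n G a m (\<lambda>x. z \<cdot>\<^sub>m L x) k K = (\<Sum>i\<le>n - 2. \<Sum>x\<in>G.
      mat_trace (word_prod m (\<lambda>x. z \<cdot>\<^sub>m L x) (translate_word a (i, x))) *
      cnj (mat_trace (word_prod k K (translate_word a (i, x)))))"
    by (simp add: char_pairing_def translates_def sum.cartesian_product)
  also have "\<dots> = (\<Sum>i\<le>n - 2. \<Sum>x\<in>G. z * (mat_trace (word_prod m L (translate_word a (i, x))) *
      cnj (mat_trace (word_prod k K (translate_word a (i, x)))) * z ^ i))"
    by (intro sum.cong refl) (simp only: * mult_ac)
  finally show ?thesis by (simp only: sum_distrib_left sum_distrib_right)
qed

text \<open>If no twist \<open>z \<cdot> L\<close> by an \<open>(n - 1)\<close>-th root of unity \<open>z\<close> were equivalent to \<open>K\<close>, the polynomial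
  in \<open>z\<close> of \<open>char_pairing_twist\<close>, of degree at most \<open>n - 2\<close>, would have \<open>n - 1\<close> roots; but its
  constant coefficient is positive.\<close>

lemma equal_characters_similar:
  assumes fin: "finite G" and a: "a \<in> G"
    and L: "irreducible_rep n G f m L" and K: "irreducible_rep n G f k K"
    and eq: "rep_character G L = rep_character G K" and p: "p \<in> G" "L p = 1\<^sub>m m"
  obtains S R where "S \<in> carrier_mat m k" "R \<in> carrier_mat k m" "S * R = 1\<^sub>m m" "R * S = 1\<^sub>m k"
    "\<And>y. y \<in> G \<Longrightarrow> L y * S = S * K y"
proof -
  note repL = irreducible_rep_representation[OF L] and repK = irreducible_rep_representation[OF K]
  have tr: "mat_trace (L x) = mat_trace (K x)" if "x \<in> G" for x
    using fun_cong[OF eq, of x] that by (simp add: rep_character_def)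
  have m: "m > 0" using representationD(1)[OF repL] by simp
  define s where "s i = (\<Sum>x\<in>G. mat_trace (word_prod m L (translate_word a (i, x))) *
      cnj (mat_trace (word_prod k K (translate_word a (i, x)))))" for i
  have pair: "char_pairing n G a m (\<lambda>x. z \<cdot>\<^sub>m L x) k K = z * (\<Sum>i\<le>n - 2. s i * z ^ i)" for z
    unfolding s_def by (rule char_pairing_twist[OF repL a])
  \<comment> \<open>For \<open>i = 0\<close> the words are single letters, on which the two traces
    agree, so the constant coefficient is a sum of squared absolute values.\<close>
  have "s 0 = (\<Sum>x\<in>G. of_real ((cmod (mat_trace (L x)))\<^sup>2))"
    unfolding s_def complex_norm_square using representationD(2)[OF repL] representationD(2)[OF repK] tr
    by (intro sum.cong) (simp_all add: translate_word_def right_mult_one_mat[of _ m m] right_mult_one_mat[of _ k k])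
  also have "\<dots> = of_real (\<Sum>x\<in>G. (cmod (mat_trace (L x)))\<^sup>2)" by simp
  \<comment> \<open>The term at \<open>p\<close> is positive, since \<open>L p\<close> is the
    identity and has trace \<open>m\<close>.\<close>
  also have "(\<Sum>x\<in>G. (cmod (mat_trace (L x)))\<^sup>2) > 0"
    using fin p m by (intro sum_pos2[of _ p]) auto
  then have "of_real (\<Sum>x\<in>G. (cmod (mat_trace (L x)))\<^sup>2) \<noteq> (0 :: complex)"
    by (metis less_irrefl of_real_eq_0_iff)
  finally have s0: "s 0 \<noteq> 0" .
  have "\<exists>z. z ^ (n - 1) = 1 \<and> (\<Sum>i\<le>n - 2. s i * z ^ i) \<noteq> 0"
  proof (rule ccontr)
    assume "\<not> ?thesis"
    then have "{z :: complex. z ^ (n - 1) = 1} \<subseteq> {z. (\<Sum>i\<le>n - 2. s i * z ^ i) = 0}" by auto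
    then have "card {z :: complex. z ^ (n - 1) = 1} \<le> n - 2"
      using polyfun_rootbound[of s 0 "n - 2"] s0 card_mono by (meson le0 order_trans)
    then show False using card_roots_unity_eq[of "n - 1"] arity by simp
  qed
  then obtain z where z: "z ^ (n - 1) = 1" "(\<Sum>i\<le>n - 2. s i * z ^ i) \<noteq> 0" by blast
  have "z \<noteq> 0" using z(1) arity by (auto simp: power_0_left)
  then have nz: "char_pairing n G a m (\<lambda>x. z \<cdot>\<^sub>m L x) k K \<noteq> 0" using pair z(2) by simp
  note zL = irreducible_rep_twist[OF L z(1) arity]
  obtain S R where S: "S \<in> carrier_mat m k" "R \<in> carrier_mat k m" "S * R = 1\<^sub>m m" "R * S = 1\<^sub>m k"
    and zS: "\<And>y. y \<in> G \<Longrightarrow> z \<cdot>\<^sub>m L y * S = S * K y"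
    using char_pairing_nonzero[OF fin a zL K nz] by metis
  \<comment> \<open>The twist is trivial: at \<open>p\<close> the traces of \<open>z L\<close> and
    \<open>K\<close> agree, the first being \<open>z m\<close> and the second \<open>m\<close> by
    equality of the characters.\<close>
  have "mat_trace (word_prod m (\<lambda>x. z \<cdot>\<^sub>m L x) [p]) = mat_trace (word_prod k K [p])"
    by (rule mat_trace_word_similar[OF irreducible_rep_representation[OF zL] repK _ S zS])
      (use p in auto)
  then have "z * of_nat m = of_nat m"
    using p tr[OF p(1)] representationD(2)[OF repL p(1)] representationD(2)[OF repK p(1)]
    by (simp add: right_mult_one_mat mat_trace_smult[of _ m])
  then have "z = 1" using m by simp
  then show ?thesis using that S zS by (simp add: one_smult_mat)
qed

text \<open>Equal characters give equivalent representations, so the pairing is that of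
  \<open>L\<close> with itself. Conversely, a nonzero pairing would give an equivalence and hence
  equal characters.\<close>

lemma character_orthogonality:
  assumes fin: "finite G" and a: "a \<in> G"
    and L: "irreducible_rep n G f m L" and p: "p \<in> G" "L p = 1\<^sub>m m"
    and K: "irreducible_rep n G f k K"
  shows "char_pairing n G a m L k K =
    (if rep_character G L = rep_character G K then of_nat ((n - 1) * card G) else 0)"
proof (cases "rep_character G L = rep_character G K")
  case True
  note repL = irreducible_rep_representation[OF L] and repK = irreducible_rep_representation[OF K]
  obtain S R where S: "S \<in> carrier_mat m k" "R \<in> carrier_mat k m" "S * R = 1\<^sub>m m" "R * S = 1\<^sub>m k"
    "\<And>y. y \<in> G \<Longrightarrow> L y * S = S * K y"
    using equal_characters_similar[OF fin a L K True p] by metis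
  have "char_pairing n G a m L k K = char_pairing n G a m L m L"
    unfolding char_pairing_def
    by (intro sum.cong refl) (simp add: mat_trace_word_similar[OF repL repK translate_word_set[OF a] S])
  then show ?thesis
    using True char_pairing_self[OF fin a L] by (simp add: translates_def card_cartesian_product)
next
  case False
  have "char_pairing n G a m L k K = 0"
  proof (rule ccontr)
    assume "\<not> ?thesis"
    then obtain S R where S: "S \<in> carrier_mat m k" "R \<in> carrier_mat k m" "S * R = 1\<^sub>m m" "R * S = 1\<^sub>m k"
      "\<And>y. y \<in> G \<Longrightarrow> L y * S = S * K y"
      using char_pairing_nonzero[OF fin a L K] by metis
    note repL = irreducible_rep_representation[OF L] and repK = irreducible_rep_representation[OF K]
    have "mat_trace (L x) = mat_trace (K x)" if x: "x \<in> G" for x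
      using mat_trace_word_similar[OF repL repK _ S, of "[x]"] x
        representationD(2)[OF repL x] representationD(2)[OF repK x] by simp
    \<comment> \<open>Off \<open>G\<close> both characters are \<open>undefined\<close>, so
      agreement on \<open>G\<close> is equality of functions.\<close>
    then show False using False by (auto simp: rep_character_def restrict_def fun_eq_iff split: if_splits)
  qed
  then show ?thesis using False by simp
qed

end

theorem theorem3p2:
  fixes n :: nat and G :: "'a set" and f :: "'a list \<Rightarrow> 'a"
    and \<chi> \<psi> :: "'a \<Rightarrow> complex" and p q a :: 'a
  assumes "n \<ge> 2"
    and "polyadic_group n G f"
    and "finite G"
    and "\<chi> \<in> Irr n G f" and "\<psi> \<in> Irr n G f"
    and "p \<in> char_kernel n G f \<chi>" and "q \<in> char_kernel n G f \<psi>"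
    and "a \<in> G"
  shows "1 / (of_nat (n - 1) * of_nat (card G)) *
      (\<Sum>i = 0..n - 2. \<Sum>x\<in>G.
        \<chi> (f ([x] @ replicate i a @ replicate (n - i - 1) p)) *
        cnj (\<psi> (f ([x] @ replicate i a @ replicate (n - i - 1) q)))) =
      (if \<chi> = \<psi> then 1 else 0)"
proof -
  interpret polyadic_group n G f by fact
  \<comment> \<open>The witness comes from the kernel, so that one and the same representation has
    character \<open>\<chi>\<close> and sends \<open>p\<close> to the identity; likewise for
    \<open>\<psi>\<close> and \<open>q\<close>.\<close>
  obtain m L where L: "irreducible_rep n G f m L" "rep_character G L = \<chi>" "p \<in> G" "L p = 1\<^sub>m m"
    using assms(6) by (auto simp: char_kernel_def)
  obtain k K where K: "irreducible_rep n G f k K" "rep_character G K = \<psi>" "q \<in> G" "K q = 1\<^sub>m k"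
    using assms(7) by (auto simp: char_kernel_def)
  have index: "{..<n - 1} = {0..n - 2}" using assms(1) by auto
  have pairing: "char_pairing n G a m L k K = (\<Sum>i = 0..n - 2. \<Sum>x\<in>G.
      mat_trace (word_prod m L (translate_word a (i, x))) *
      cnj (mat_trace (word_prod k K (translate_word a (i, x)))))"
    unfolding char_pairing_def translates_def index by (simp add: sum.cartesian_product)
  have "(\<Sum>i = 0..n - 2. \<Sum>x\<in>G.
        \<chi> (f ([x] @ replicate i a @ replicate (n - i - 1) p)) *
        cnj (\<psi> (f ([x] @ replicate i a @ replicate (n - i - 1) q)))) = char_pairing n G a m L k K"
    unfolding pairing L(2)[symmetric] K(2)[symmetric]
  proof (intro sum.cong refl)
    fix i x assume "i \<in> {0..n - 2}" and x: "x \<in> G"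
    then have i: "i \<le> n - 2" by simp
    show "rep_character G L (f ([x] @ replicate i a @ replicate (n - i - 1) p)) *
        cnj (rep_character G K (f ([x] @ replicate i a @ replicate (n - i - 1) q))) =
      mat_trace (word_prod m L (translate_word a (i, x))) *
        cnj (mat_trace (word_prod k K (translate_word a (i, x))))"
      using rep_character_translate[OF irreducible_rep_representation[OF L(1)] L(3,4) assms(8) x i]
        rep_character_translate[OF irreducible_rep_representation[OF K(1)] K(3,4) assms(8) x i]
      by (simp only:)
  qed
  also have "\<dots> = (if \<chi> = \<psi> then of_nat ((n - 1) * card G) else 0)"
    using character_orthogonality[OF assms(3,8) L(1,3,4) K(1)] L(2) K(2) by simp
  finally show ?thesis
    using assms(1,3) nonempty by (simp add: card_gt_0_iff)
qed

end
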